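(* Let $n\ge1$ and $0\le m\le n$ be integers, let $a_j,b_{jj}\in C^1_{2\pi}$ for $j\le n$ with $a_j(x,t)\neq0$ for all $(x,t)\in[0,1]\times\mathbb{R}$, and let $p_{jk}\in C_{2\pi}(\mathbb{R})$ for $j,k\le n$. Put $x_j=0$ for $1\le j\le m$ and $x_j=1$ for $m<j\le n$. Let $C:C_{n,2\pi}\to C_{n,2\pi}$ be the operator $$(Cv)_j(x,t)=c_j(x_j,x,t)\sum_{k=1}^np_{jk}(\omega_j(x_j,x,t))\,v_k(1-x_k,\omega_j(x_j,x,t)),\qquad j\le n,$$ associated with the reflection boundary conditions $$u_j(x_j,t)=\sum_{k=m+1}^np_{jk}(t)u_k(0,t)+\sum_{k=1}^mp_{jk}(t)u_k(1,t),\qquad j\le n.$$ Let $Q(t)=(Q_{jk}(t))_{j,k=1}^n$ be the matrix with entries $$Q_{jk}(t)=\begin{cases} c_j(0,1,\omega_j(1,0,t))\,p_{jk}(t), & 1\le j\le m,\\ c_j(1,0,\omega_j(0,1,t))\,p_{jk}(t), & m<j\le n.\end{cases}$$ If $Q(t)$ is invertible for all $t\in\mathbb{R}$ and $\|Q^{-1}(t)\|_\infty<1$ for all $t\in\mathbb{R}$, then $I-C:C_{n,2\pi}\to C_{n,2\pi}$ is bijective; in particular, the system $u=Cu$ is uniquely solvable in $C_{n,2\pi}$ (only $u=0$).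
   Context: $C_{n,2\pi}$ is the Banach space of all continuous maps $u:[0,1]\times\mathbb{R}\to\mathbb{R}^n$ that are $2\pi$-periodic in the second variable $t$, with the sup norm (maximum over components, $x$ and $t$). $C^1_{2\pi}$ is the space of continuously differentiable functions $[0,1]\times\mathbb{R}\to\mathbb{R}$ that are $2\pi$-periodic in the second variable. $C_{2\pi}(\mathbb{R})$ is the space of continuous $2\pi$-periodic functions $\mathbb{R}\to\mathbb{R}$. For an $n\times n$ matrix $M$, $\|M\|_\infty=\max_{j}\sum_k|M_{jk}|$ is the operator norm induced by the maximum norm on $\mathbb{R}^n$. For $j\le n$, $x\in[0,1]$, $t\in\mathbb{R}$, the $j$-th characteristic $\xi\in[0,1]\mapsto\omega_j(\xi,x,t)\in\mathbb{R}$ is the solution of $$\partial_\xi\omega_j(\xi,x,t)=\frac{1}{a_j(\xi,\omega_j(\xi,x,t))},\qquad \omega_j(x,x,t)=t,$$ and $$c_j(\xi,x,t)=\exp\int_x^\xi\Big(\frac{b_{jj}}{a_j}\Big)(\eta,\omega_j(\eta,x,t))\,d\eta.$$ *)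

theory Defs
  imports "HOL-Analysis.Analysis"
begin

definition strip :: "(real \<times> real) set" where
  "strip = {0..1} \<times> UNIV"

text \<open>A function on the strip is represented by its extension by zero, so that equality of
  elements of the space is equality of functions on the strip.\<close>

definition C_n2pi :: "(real \<times> real \<Rightarrow> real ^ 'n) set" where
  "C_n2pi = {u. continuous_on strip u \<and>
      (\<forall>x\<in>{0..1}. \<forall>t. u (x, t + 2 * pi) = u (x, t)) \<and>
      (\<forall>z. z \<notin> strip \<longrightarrow> u z = 0)}"

text \<open>\<open>f\<^sub>x\<close> and \<open>f\<^sub>t\<close> are the partial derivatives, one-sided in the first variable on the
  two edges of the strip. The values of \<open>f\<close> outside the strip are irrelevant.\<close>

definition C1_2pi :: "(real \<times> real \<Rightarrow> real) set" where
  "C1_2pi = {f.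
      (\<exists>f\<^sub>x f\<^sub>t. continuous_on strip f\<^sub>x \<and> continuous_on strip f\<^sub>t \<and>
        (\<forall>z\<in>strip. (f has_derivative (\<lambda>(h, k). f\<^sub>x z * h + f\<^sub>t z * k)) (at z within strip))) \<and>
      (\<forall>x\<in>{0..1}. \<forall>t. f (x, t + 2 * pi) = f (x, t))}"

definition C_2pi :: "(real \<Rightarrow> real) set" where
  "C_2pi = {f. continuous_on UNIV f \<and> (\<forall>t. f (t + 2 * pi) = f t)}"

text \<open>The value at \<open>\<xi>\<close> of the solution \<open>w\<close> on \<open>[0,1]\<close> of \<open>w' = 1 / a(\<cdot>, w)\<close>, \<open>w(x) = t\<close>.
  The description picks the value \<open>w \<xi>\<close> rather than \<open>w\<close> because the solution is determined
  only on \<open>[0,1]\<close>.\<close>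

definition charac :: "(real \<times> real \<Rightarrow> real) \<Rightarrow> real \<Rightarrow> real \<Rightarrow> real \<Rightarrow> real" where
  "charac a \<xi> x t = (THE y. \<exists>w.
      (\<forall>\<eta>\<in>{0..1}. (w has_real_derivative 1 / a (\<eta>, w \<eta>)) (at \<eta> within {0..1})) \<and>
      w x = t \<and> w \<xi> = y)"

definition cweight ::
  "(real \<times> real \<Rightarrow> real) \<Rightarrow> (real \<times> real \<Rightarrow> real) \<Rightarrow> real \<Rightarrow> real \<Rightarrow> real \<Rightarrow> real" where
  "cweight a b \<xi> x t =
      exp (LBINT \<eta>=ereal x..ereal \<xi>. b (\<eta>, charac a \<eta> x t) / a (\<eta>, charac a \<eta> x t))"

text \<open>The index type \<open>'n\<close> stands for \<open>{1..n}\<close> with \<open>n = CARD('n)\<close>; the bijection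
  \<open>\<iota> :: 'n \<Rightarrow> nat\<close> onto \<open>{1..n}\<close> (assumed where these definitions are used) numbers it.\<close>

definition inflow :: "('n \<Rightarrow> nat) \<Rightarrow> nat \<Rightarrow> 'n \<Rightarrow> real" where
  "inflow \<iota> m j = (if \<iota> j \<le> m then 0 else 1)"

text \<open>\<open>b j\<close> is the diagonal coefficient \<open>b\<^sub>j\<^sub>j\<close>.\<close>

definition reflection_op ::
  "('n::finite \<Rightarrow> nat) \<Rightarrow> nat \<Rightarrow> ('n \<Rightarrow> real \<times> real \<Rightarrow> real) \<Rightarrow> ('n \<Rightarrow> real \<times> real \<Rightarrow> real)
    \<Rightarrow> ('n \<Rightarrow> 'n \<Rightarrow> real \<Rightarrow> real) \<Rightarrow> (real \<times> real \<Rightarrow> real ^ 'n) \<Rightarrow> (real \<times> real \<Rightarrow> real ^ 'n)" where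
  "reflection_op \<iota> m a b p v = (\<lambda>(x, t).
      if (x, t) \<in> strip then
        (\<chi> j. cweight (a j) (b j) (inflow \<iota> m j) x t *
          (\<Sum>k\<in>UNIV. p j k (charac (a j) (inflow \<iota> m j) x t) *
             v (1 - inflow \<iota> m k, charac (a j) (inflow \<iota> m j) x t) $ k))
      else 0)"

definition Qmat ::
  "('n::finite \<Rightarrow> nat) \<Rightarrow> nat \<Rightarrow> ('n \<Rightarrow> real \<times> real \<Rightarrow> real) \<Rightarrow> ('n \<Rightarrow> real \<times> real \<Rightarrow> real)
    \<Rightarrow> ('n \<Rightarrow> 'n \<Rightarrow> real \<Rightarrow> real) \<Rightarrow> real \<Rightarrow> real ^ 'n ^ 'n" where
  "Qmat \<iota> m a b p t = (\<chi> j k.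
      if \<iota> j \<le> m then cweight (a j) (b j) 0 1 (charac (a j) 1 0 t) * p j k t
      else cweight (a j) (b j) 1 0 (charac (a j) 0 1 t) * p j k t)"

definition mat_norm_inf :: "real ^ 'n ^ 'n::finite \<Rightarrow> real" where
  "mat_norm_inf M = (MAX j. \<Sum>k\<in>UNIV. \<bar>M $ j $ k\<bar>)"

end

theory Submission
  imports Defs
begin

text \<open>The value of \<open>C v\<close> depends on \<open>v\<close> only through its traces \<open>y\<^sub>k(t) = v\<^sub>k(1 - x\<^sub>k, t)\<close> at the
  ends where the characteristics leave the strip, so \<open>v = C v + f\<close> is equivalent to an equation for
  the periodic function \<open>y\<close> alone. Evaluating that equation at the exit time of the characteristic
  that enters at time \<open>s\<close> gives \<open>y(exit) = Q(s) y(s) + g(exit)\<close>, componentwise with its own exit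
  time. Solving for \<open>y(s)\<close> exhibits \<open>y\<close> as a fixed point of a map that contracts the maximum norm
  with constant \<open>sup \<parallel>Q\<^sup>-\<^sup>1(t)\<parallel>\<^sub>\<infinity>\<close>, and this is less than 1 by continuity and periodicity.\<close>

subsection \<open>Flows of Lipschitz fields\<close>

lemma integral_rescaled_interval:
  fixes f g :: "real \<Rightarrow> real"
  assumes f: "\<And>s. (f has_real_derivative g s) (at s)" and g: "continuous_on UNIV g"
  shows "(y - x) * integral {0..1} (\<lambda>r. g (x + r * (y - x))) = f y - f x"
proof -
  have "((\<lambda>r. g (x + r * (y - x)) * (y - x)) has_integral
      f (x + 1 * (y - x)) - f (x + 0 * (y - x))) {0..1}"
    by (rule fundamental_theorem_of_calculus)
      (auto simp flip: has_real_derivative_iff_has_vector_derivative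
        intro!: derivative_eq_intros DERIV_chain2[OF f])
  then show ?thesis
    by (simp add: has_integral_iff mult.commute)
qed

lemma antiderivative_real:
  fixes g :: "real \<Rightarrow> real"
  assumes "continuous_on UNIV g"
  obtains f where "\<And>s. (f has_real_derivative g s) (at s)"
proof -
  have "\<exists>f. \<forall>s. -\<infinity> < ereal s \<longrightarrow> ereal s < \<infinity> \<longrightarrow> (f has_vector_derivative g s) (at s)"
    by (rule einterval_antiderivative)
      (use assms in \<open>auto simp: continuous_on_eq_continuous_at\<close>)
  then show ?thesis
    using that by (auto simp: has_real_derivative_iff_has_vector_derivative)
qed

text \<open>The segment from \<open>x\<close> to \<open>y\<close> is parametrised over the fixed
  domain [0,1]. This covers both orders of the endpoints at once and makes continuity in the
  endpoints a matter of parameter integrals; the derivative comes from an antiderivative.\<close>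

lemma rescaled_integral_derivative:
  fixes g :: "real \<Rightarrow> real"
  assumes g: "continuous_on UNIV g"
  shows "((\<lambda>y. (y - x) * integral {0..1} (\<lambda>r. g (x + r * (y - x)))) has_real_derivative g y) (at y)"
proof -
  obtain f where f: "\<And>s. (f has_real_derivative g s) (at s)"
    using antiderivative_real[OF g] by blast
  show ?thesis
    unfolding integral_rescaled_interval[OF f g]
    by (auto intro!: derivative_eq_intros f)
qed

lemma interval_integral_rescaled:
  fixes g :: "real \<Rightarrow> real"
  assumes g: "continuous_on UNIV g"
  shows "(LBINT s=ereal x..ereal y. g s) = (y - x) * integral {0..1} (\<lambda>r. g (x + r * (y - x)))"
proof -
  obtain f where f: "\<And>s. (f has_real_derivative g s) (at s)"
    using antiderivative_real[OF g] by blast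
  have "(LBINT s=ereal x..ereal y. g s) = f y - f x"
    by (rule interval_integral_FTC_finite)
      (auto simp flip: has_real_derivative_iff_has_vector_derivative
        intro: continuous_on_subset[OF g] has_field_derivative_at_within f)
  then show ?thesis
    by (simp only: integral_rescaled_interval[OF f g])
qed

text \<open>Integrating the Picard weight from the base point yields the factor
  \<open>1 / K\<close>, which is where the contraction constant \<open>L / K\<close> comes
  from.\<close>

lemma integral_exp_rescaled:
  fixes K h :: real
  assumes "K > 0"
  shows "\<bar>h\<bar> * integral {0..1} (\<lambda>r. exp (K * \<bar>r * h\<bar>)) = (exp (K * \<bar>h\<bar>) - 1) / K"
proof -
  have "integral {0..1} (\<lambda>r. exp (K * \<bar>r * h\<bar>)) = integral {0..1} (\<lambda>r. exp (K * (0 + r * (\<bar>h\<bar> - 0))))"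
    by (rule integral_cong) (auto simp: abs_mult)
  moreover have "(\<bar>h\<bar> - 0) * integral {0..1} (\<lambda>r. exp (K * (0 + r * (\<bar>h\<bar> - 0)))) =
      exp (K * \<bar>h\<bar>) / K - exp (K * 0) / K"
    using assms
    by (intro integral_rescaled_interval[where f = "\<lambda>s. exp (K * s) / K" and g = "\<lambda>s. exp (K * s)"])
      (auto intro!: derivative_eq_intros continuous_intros)
  ultimately show ?thesis
    by (simp add: diff_divide_distrib)
qed

text \<open>Weighting with \<open>exp (K * \<bar>\<eta> - x\<bar>)\<close> makes the Picard operator a contraction on the
  bounded continuous functions of all three variables \<open>(\<eta>, x, t)\<close>, so that the joint continuity
  of the flow comes for free.\<close>

lemma lipschitz_flow_exists:
  fixes F :: "real \<times> real \<Rightarrow> real"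
  assumes cont: "continuous_on UNIV F"
    and bnd: "\<And>z. \<bar>F z\<bar> \<le> M"
    and lip: "\<And>s y y'. \<bar>F (s, y) - F (s, y')\<bar> \<le> L * \<bar>y - y'\<bar>"
  obtains W where "continuous_on UNIV (\<lambda>(\<eta>, x, t). W \<eta> x t)"
    and "\<And>x t. W x x t = t"
    and "\<And>\<eta> x t. ((\<lambda>s. W s x t) has_real_derivative F (\<eta>, W \<eta> x t)) (at \<eta>)"
proof -
  \<comment> \<open>This choice gives \<open>K > 0\<close> even for \<open>L = 0\<close>, and a
    contraction factor of at most 1/2.\<close>
  define K where "K = 2 * \<bar>L\<bar> + 1"
  have K: "K > 0" "\<bar>L\<bar> / K \<le> 1 / 2" "\<bar>L\<bar> \<ge> 0"
    by (auto simp: K_def divide_simps)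
  have M: "M \<ge> 0"
    using bnd[of 0] by linarith
  have lip': "\<bar>F (s, y) - F (s, y')\<bar> \<le> \<bar>L\<bar> * \<bar>y - y'\<bar>" for s y y'
    using lip[of s y y'] by (smt (verit) abs_ge_self mult_right_mono abs_ge_zero)
  \<comment> \<open>The unknown \<open>u\<close> is the displacement from \<open>t\<close> divided
    by the weight \<open>exp (K * |\<eta> - x|)\<close>. \<open>G\<close> is the slope along the
    curve that \<open>u\<close> encodes, sampled on the rescaled segment; \<open>P\<close> is its
    integral divided by the same weight.\<close>
  define G :: "((real \<times> real \<times> real) \<Rightarrow>\<^sub>C real) \<Rightarrow> real \<times> real \<times> real \<Rightarrow> real \<Rightarrow> real" where
    "G u = (\<lambda>(\<eta>, x, t) r. F (x + r * (\<eta> - x), t + exp (K * \<bar>r * (\<eta> - x)\<bar>) * u (x + r * (\<eta> - x), x, t)))" for u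
  define P :: "((real \<times> real \<times> real) \<Rightarrow>\<^sub>C real) \<Rightarrow> real \<times> real \<times> real \<Rightarrow> real" where
    "P u z = exp (- K * \<bar>fst z - fst (snd z)\<bar>) * ((fst z - fst (snd z)) * integral {0..1} (G u z))" for u z
  have u_comp: "continuous_on S (\<lambda>x. apply_bcontfun u (f x))" if "continuous_on S f"
    for S :: "'b::topological_space set" and f and u :: "(real \<times> real \<times> real) \<Rightarrow>\<^sub>C real"
    using that by (rule continuous_on_compose2[OF continuous_on_apply_bcontfun[of UNIV]]) auto
  have F_comp: "continuous_on S (\<lambda>x. F (f x))" if "continuous_on S f"
    for S :: "'b::topological_space set" and f
    using that by (rule continuous_on_compose2[OF cont]) auto
  have G_cont: "continuous_on UNIV (\<lambda>(z, r). G u z r)" for u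
    unfolding G_def case_prod_beta by (intro F_comp u_comp continuous_intros)
  have G_cont_r: "continuous_on S (G u z)" for u z S
    by (rule continuous_on_compose2[OF G_cont, of _ "\<lambda>r. (z, r)", simplified]) (auto intro!: continuous_intros)
  have G_int: "G u z integrable_on {0..1}" for u z
    by (rule integrable_continuous_real[OF G_cont_r])
  have int_cont: "continuous_on UNIV (\<lambda>z. integral {0..1} (G u z))" for u
    using integral_continuous_on_param[of UNIV 0 1 "G u"] continuous_on_subset[OF G_cont] by auto
  have P_cont: "continuous_on UNIV (P u)" for u
    unfolding P_def by (intro continuous_intros int_cont)
  have G_bnd: "\<bar>G u z r\<bar> \<le> M" for u z r
    by (cases z) (auto simp: G_def bnd)
  \<comment> \<open>The plain Picard integral grows linearly in \<open>h\<close>. The weight makes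
    it bounded, because \<open>K * h * exp (- K * h)\<close> never exceeds 1.\<close>
  have P_bnd: "\<bar>P u z\<bar> \<le> M / K" for u z
  proof -
    define h where "h = \<bar>fst z - fst (snd z)\<bar>"
    have "\<bar>integral {0..1} (G u z)\<bar> \<le> M * (1 - 0)"
      using integral_bound[of 0 1 "G u z" M] G_cont_r G_bnd by auto
    then have "\<bar>P u z\<bar> \<le> exp (- K * h) * (h * M)"
      unfolding P_def h_def abs_mult by (intro mult_mono) auto
    also have "\<dots> = (K * h) * exp (- (K * h)) * (M / K)"
      using K by (simp add: field_simps)
    also have "\<dots> \<le> 1 * (M / K)"
    proof (rule mult_right_mono)
      have "K * h \<le> exp (K * h)"
        using exp_ge_add_one_self[of "K * h"] by linarith
      then show "K * h * exp (- (K * h)) \<le> 1"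
        by (simp add: exp_minus field_simps)
    qed (use M K in auto)
    finally show ?thesis by simp
  qed
  have P_mem: "P u \<in> bcontfun" for u
    by (rule bcontfun_normI[OF P_cont]) (use P_bnd in auto)
  define T where "T u = Bcontfun (P u)" for u
  have T_apply: "apply_bcontfun (T u) = P u" for u
    unfolding T_def by (rule Bcontfun_inverse[OF P_mem])
  have contr: "dist (T u) (T v) \<le> 1 / 2 * dist u v" for u v
  proof (rule dist_bound)
    fix z :: "real \<times> real \<times> real"
    obtain \<eta> x t where z: "z = (\<eta>, x, t)" by (cases z) auto
    define h where "h = \<eta> - x"
    define D where "D = dist u v"
    have D: "\<bar>u z' - v z'\<bar> \<le> D" for z'
      using dist_bounded[of u z' v] by (simp add: D_def dist_real_def)
    have D0: "D \<ge> 0" by (simp add: D_def)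
    have "\<bar>integral {0..1} (G u z) - integral {0..1} (G v z)\<bar> =
        norm (integral {0..1} (\<lambda>r. G u z r - G v z r))"
      by (simp add: integral_diff G_int)
    also have "\<dots> \<le> integral {0..1} (\<lambda>r. \<bar>L\<bar> * D * exp (K * \<bar>r * h\<bar>))"
    proof (rule integral_norm_bound_integral)
      show "(\<lambda>r. G u z r - G v z r) integrable_on {0..1}"
        by (intro integrable_diff G_int)
      show "(\<lambda>r. \<bar>L\<bar> * D * exp (K * \<bar>r * h\<bar>)) integrable_on {0..1}"
        by (intro integrable_continuous_real continuous_intros)
      fix r :: real
      define e where "e = exp (K * \<bar>r * h\<bar>)"
      define z' where "z' = (x + r * (\<eta> - x), x, t)"
      have "norm (G u z r - G v z r) \<le> \<bar>L\<bar> * \<bar>(t + e * u z') - (t + e * v z')\<bar>"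
        unfolding G_def z e_def h_def z'_def prod.case real_norm_def by (rule lip')
      also have "\<bar>(t + e * u z') - (t + e * v z')\<bar> = e * \<bar>u z' - v z'\<bar>"
        by (simp add: e_def abs_mult flip: right_diff_distrib)
      also have "\<bar>L\<bar> * \<dots> \<le> \<bar>L\<bar> * (e * D)"
        using D[of z'] by (intro mult_left_mono) (auto simp: e_def)
      finally show "norm (G u z r - G v z r) \<le> \<bar>L\<bar> * D * exp (K * \<bar>r * h\<bar>)"
        by (simp add: e_def mult_ac)
    qed
    also have "\<dots> = \<bar>L\<bar> * D * integral {0..1} (\<lambda>r. exp (K * \<bar>r * h\<bar>))"
      by simp
    finally have *: "\<bar>integral {0..1} (G u z) - integral {0..1} (G v z)\<bar> \<le> \<dots>" .
    have "dist (T u z) (T v z) =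
        exp (- K * \<bar>h\<bar>) * (\<bar>h\<bar> * \<bar>integral {0..1} (G u z) - integral {0..1} (G v z)\<bar>)"
      by (simp add: T_apply P_def z h_def dist_real_def abs_mult flip: right_diff_distrib)
    also have "\<dots> \<le> exp (- K * \<bar>h\<bar>) * (\<bar>h\<bar> * (\<bar>L\<bar> * D * integral {0..1} (\<lambda>r. exp (K * \<bar>r * h\<bar>))))"
      by (intro mult_left_mono *) auto
    also have "\<dots> = exp (- K * \<bar>h\<bar>) * (\<bar>L\<bar> * D * (\<bar>h\<bar> * integral {0..1} (\<lambda>r. exp (K * \<bar>r * h\<bar>))))"
      by (simp only: mult_ac)
    also have "\<dots> = \<bar>L\<bar> / K * D * (1 - exp (- K * \<bar>h\<bar>))"
      unfolding integral_exp_rescaled[OF K(1)] by (simp add: exp_minus field_simps)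
    also have "\<dots> \<le> \<bar>L\<bar> / K * D * 1"
      using K D0 by (intro mult_left_mono) auto
    also have "\<dots> \<le> 1 / 2 * D"
      using mult_right_mono[OF K(2) D0] by simp
    finally show "dist (T u z) (T v z) \<le> 1 / 2 * dist u v"
      by (simp add: D_def)
  qed
  then have "\<exists>!u. T u = u"
    by (intro banach_fix_type[of "1 / 2"]) auto
  then obtain u where "T u = u" by blast
  then have u: "apply_bcontfun u z = P u z" for z
    by (metis T_apply)
  define W where "W \<eta> x t = t + exp (K * \<bar>\<eta> - x\<bar>) * u (\<eta>, x, t)" for \<eta> x t
  \<comment> \<open>Undoing the weight turns the fixed-point equation into the Picard integral
    equation.\<close>
  have W_int: "W \<eta> x t = t + (\<eta> - x) * integral {0..1} (\<lambda>r. F (x + r * (\<eta> - x), W (x + r * (\<eta> - x)) x t))"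
    for \<eta> x t
    unfolding W_def by (subst u) (simp add: P_def G_def exp_minus field_simps)
  have W_cont: "continuous_on UNIV (\<lambda>(\<eta>, x, t). W \<eta> x t)"
    unfolding W_def case_prod_beta by (intro u_comp continuous_intros)
  have W_eta: "continuous_on S (\<lambda>s. W s x t)" for x t S
    unfolding W_def by (intro u_comp continuous_intros)
  show ?thesis
  proof (rule that[OF W_cont])
    show "W x x t = t" for x t
      by (subst W_int) simp
    show "((\<lambda>s. W s x t) has_real_derivative F (\<eta>, W \<eta> x t)) (at \<eta>)" for \<eta> x t
    proof -
      have "((\<lambda>s. t + (s - x) * integral {0..1} (\<lambda>r. F (x + r * (s - x), W (x + r * (s - x)) x t)))
          has_real_derivative 0 + F (\<eta>, W \<eta> x t)) (at \<eta>)"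
        by (intro DERIV_add DERIV_const rescaled_integral_derivative[where g = "\<lambda>s. F (s, W s x t)"]
            F_comp W_eta continuous_intros)
      then show ?thesis
        by (simp flip: W_int)
    qed
  qed
qed

text \<open>A Gronwall argument for the squared difference \<open>d\<close>, which is differentiable
  where an absolute value need not be. Since |d'| is at most 2 L d, the function
  \<open>d * exp (- 2 * L * s)\<close> is nonincreasing and \<open>d * exp (2 * L * s)\<close> is
  nondecreasing; these settle the points after and before \<open>x\<close>.\<close>

lemma lipschitz_ode_unique:
  fixes F :: "real \<times> real \<Rightarrow> real"
  assumes lip: "\<And>s y y'. s \<in> {0..1} \<Longrightarrow> \<bar>F (s, y) - F (s, y')\<bar> \<le> L * \<bar>y - y'\<bar>"
    and w: "\<And>s. s \<in> {0..1} \<Longrightarrow> (w has_real_derivative F (s, w s)) (at s within {0..1})"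
    and w': "\<And>s. s \<in> {0..1} \<Longrightarrow> (w' has_real_derivative F (s, w' s)) (at s within {0..1})"
    and x: "x \<in> {0..1}" "w x = w' x" and y: "y \<in> {0..1}"
  shows "w y = w' y"
proof -
  define d where "d s = (w s - w' s)\<^sup>2" for s
  define d' where "d' s = 2 * (w s - w' s) * (F (s, w s) - F (s, w' s))" for s
  have d: "(d has_real_derivative d' s) (at s within {0..1})" if "s \<in> {0..1}" for s
    unfolding d_def d'_def using that
    by (auto intro!: derivative_eq_intros w w' simp: power2_eq_square)
  have d_bnd: "\<bar>d' s\<bar> \<le> 2 * L * d s" if "s \<in> {0..1}" for s
  proof -
    have "\<bar>d' s\<bar> = 2 * \<bar>w s - w' s\<bar> * \<bar>F (s, w s) - F (s, w' s)\<bar>"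
      by (simp only: d'_def abs_mult abs_numeral)
    also have "\<dots> \<le> 2 * \<bar>w s - w' s\<bar> * (L * \<bar>w s - w' s\<bar>)"
      using lip[OF that] by (intro mult_left_mono) auto
    also have "\<dots> = 2 * L * d s"
      by (simp add: d_def power2_eq_square abs_mult_self_eq mult_ac)
    finally show ?thesis .
  qed
  have e: "((\<lambda>s. d s * exp (c * s)) has_real_derivative (d' s + c * d s) * exp (c * s)) (at s within {0..1})"
    if "s \<in> {0..1}" for s c
    using that by (auto intro!: derivative_eq_intros d simp: algebra_simps)
  have e_cont: "continuous_on {0..1} (\<lambda>s. d s * exp (c * s))" for c
    using e by (intro DERIV_continuous_on)
  have e_at: "((\<lambda>s. d s * exp (c * s)) has_real_derivative (d' s + c * d s) * exp (c * s)) (at s)"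
    if "0 < s" "s < 1" for s c
    using e[of s c] that at_within_interior[of s "{0..1}"] by (simp add: interior_atLeastAtMost_real)
  have d_x: "d x = 0" using x by (simp add: d_def)
  have "d y \<le> 0"
  proof (cases "x \<le> y")
    case True
    have "d y * exp (- 2 * L * y) \<le> d x * exp (- 2 * L * x)"
    proof (rule DERIV_nonpos_imp_decreasing_open[OF True])
      fix s assume s: "x < s" "s < y"
      show "\<exists>D. ((\<lambda>s. d s * exp (- 2 * L * s)) has_real_derivative D) (at s) \<and> D \<le> 0"
        using e_at[of s "- 2 * L"] d_bnd[of s] s x y
        by (intro exI[of _ "(d' s + - 2 * L * d s) * exp (- 2 * L * s)"]) (auto intro!: mult_nonpos_nonneg)
    qed (use x y in \<open>intro continuous_on_subset[OF e_cont], auto\<close>)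
    then show ?thesis using d_x by (simp add: mult_le_0_iff)
  next
    case False
    then have "y \<le> x" by simp
    then have "d y * exp (2 * L * y) \<le> d x * exp (2 * L * x)"
    proof (rule DERIV_nonneg_imp_increasing_open)
      fix s assume s: "y < s" "s < x"
      show "\<exists>D. ((\<lambda>s. d s * exp (2 * L * s)) has_real_derivative D) (at s) \<and> D \<ge> 0"
        using e_at[of s "2 * L"] d_bnd[of s] s x y
        by (intro exI[of _ "(d' s + 2 * L * d s) * exp (2 * L * s)"]) (auto intro!: mult_nonneg_nonneg)
    qed (use x y in \<open>intro continuous_on_subset[OF e_cont], auto\<close>)
    then show ?thesis using d_x by (simp add: mult_le_0_iff)
  qed
  then show ?thesis
    by (simp add: d_def)
qed

subsection \<open>Characteristics and their weights\<close>

lemma strip_iff [simp]: "(x, t) \<in> strip \<longleftrightarrow> 0 \<le> x \<and> x \<le> 1"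
  by (simp add: strip_def)

lemma convex_combination_unit_interval:
  assumes "x \<in> {0..1}" "y \<in> {0..1}" "r \<in> {0..1}"
  shows "x + r * (y - x) \<in> {0..1::real}"
proof -
  have "(1 - r) *\<^sub>R x + r *\<^sub>R y \<in> {0..1}"
    by (rule convexD[OF convex_real_interval(5)]) (use assms in auto)
  then show ?thesis by (simp add: algebra_simps)
qed

lemma periodic_representative:
  fixes f :: "real \<Rightarrow> 'a"
  assumes "\<And>t. f (t + 2 * pi) = f t"
  shows "\<exists>s\<in>{0..2 * pi}. f s = f t"
proof -
  interpret periodic_fun_simple f "2 * pi"
    by standard (rule assms)
  define k where "k = \<lfloor>t / (2 * pi)\<rfloor>"
  have "of_int k \<le> t / (2 * pi)" "t / (2 * pi) \<le> of_int k + 1"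
    unfolding k_def by linarith+
  then have "t - of_int k * (2 * pi) \<in> {0..2 * pi}"
    by (simp add: field_simps)
  moreover have "f (t - of_int k * (2 * pi)) = f t"
    by (rule minus_of_int)
  ultimately show ?thesis by blast
qed

lemma strip_periodic_bounded:
  fixes f :: "real \<times> real \<Rightarrow> real"
  assumes cont: "continuous_on strip f"
    and per: "\<And>x t. x \<in> {0..1} \<Longrightarrow> f (x, t + 2 * pi) = f (x, t)"
  obtains B where "B > 0" "\<And>z. z \<in> strip \<Longrightarrow> \<bar>f z\<bar> \<le> B"
proof -
  have "compact (f ` ({0..1} \<times> {0..2 * pi}))"
    by (intro compact_continuous_image compact_Times continuous_on_subset[OF cont]) auto
  then obtain B where B: "B > 0" "\<And>z. z \<in> {0..1} \<times> {0..2 * pi} \<Longrightarrow> \<bar>f z\<bar> \<le> B"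
    using compact_imp_bounded bounded_pos by (metis imageI real_norm_def)
  have "\<bar>f z\<bar> \<le> B" if "z \<in> strip" for z
  proof (cases z)
    case (Pair x t)
    then have x: "x \<in> {0..1}" using that by simp
    obtain s where "s \<in> {0..2 * pi}" "f (x, s) = f (x, t)"
      using periodic_representative[of "\<lambda>t. f (x, t)" t] per[OF x] by auto
    then show ?thesis using B(2)[of "(x, s)"] x Pair by auto
  qed
  with B(1) show ?thesis by (rule that)
qed

lemma C1_2pi_continuous:
  assumes "f \<in> C1_2pi"
  shows "continuous_on strip f"
  using assms unfolding C1_2pi_def by (auto intro: has_derivative_continuous_on)

lemma C1_2pi_periodic:
  assumes "f \<in> C1_2pi" "x \<in> {0..1}"
  shows "f (x, t + 2 * pi) = f (x, t)"
  using assms unfolding C1_2pi_def by blast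

text \<open>The derivative in \<open>t\<close> inherits the period by uniqueness of derivatives, so
  it is bounded by compactness, and the mean value inequality applies. On a vertical slice, which is
  a full line inside the strip, the relative derivative becomes an ordinary one.\<close>

lemma C1_2pi_lipschitz:
  assumes "f \<in> C1_2pi"
  obtains L where "L > 0" "\<And>x t t'. x \<in> {0..1} \<Longrightarrow> \<bar>f (x, t) - f (x, t')\<bar> \<le> L * \<bar>t - t'\<bar>"
proof -
  obtain fx ft where ft: "continuous_on strip ft"
    and f: "\<And>z. z \<in> strip \<Longrightarrow> (f has_derivative (\<lambda>(h, k). fx z * h + ft z * k)) (at z within strip)"
    using assms unfolding C1_2pi_def by blast
  have d: "((\<lambda>t. f (x, t)) has_real_derivative ft (x, t)) (at t)" if "x \<in> {0..1}" for x t
  proof -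
    have "((\<lambda>t. (x, t)) has_derivative (\<lambda>k. (0, k))) (at t)"
      by (auto intro!: derivative_eq_intros)
    moreover have "(f has_derivative (\<lambda>(h, k). fx (x, t) * h + ft (x, t) * k))
        (at (x, t) within range (\<lambda>t. (x, t)))"
      by (rule has_derivative_subset[OF f]) (use that in auto)
    ultimately have "((\<lambda>t. f (x, t)) has_derivative
        (\<lambda>k. (\<lambda>(h, k). fx (x, t) * h + ft (x, t) * k) (0, k))) (at t)"
      by (rule has_derivative_in_compose)
    then show ?thesis
      by (simp add: has_field_derivative_def)
  qed
  have "ft (x, t + 2 * pi) = ft (x, t)" if x: "x \<in> {0..1}" for x t
  proof -
    have "((\<lambda>t. f (x, t + 2 * pi)) has_real_derivative ft (x, t + 2 * pi)) (at t)"
      using d[OF x, of "t + 2 * pi"] by (simp add: DERIV_shift)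
    then show ?thesis
      using d[OF x, of t] C1_2pi_periodic[OF assms x] by (auto intro: DERIV_unique)
  qed
  from strip_periodic_bounded[OF ft this] obtain L where
    L: "L > 0" "\<And>z. z \<in> strip \<Longrightarrow> \<bar>ft z\<bar> \<le> L" by blast
  have "\<bar>f (x, t) - f (x, t')\<bar> \<le> L * \<bar>t - t'\<bar>" if x: "x \<in> {0..1}" for x t t'
    using field_differentiable_bound[of UNIV "\<lambda>t. f (x, t)" "\<lambda>t. ft (x, t)" L t t']
      d[OF x] L(2) x by auto
  with L(1) show ?thesis by (rule that)
qed

section \<open>The characteristic flow of a single speed\<close>

locale characteristic =
  fixes a :: "real \<times> real \<Rightarrow> real"
  assumes a_C1: "a \<in> C1_2pi"
    and a_nz: "\<And>x t. x \<in> {0..1} \<Longrightarrow> a (x, t) \<noteq> 0"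
begin

lemma speed_nz: "z \<in> strip \<Longrightarrow> a z \<noteq> 0"
  using a_nz by (cases z) auto

lemma slope_bounded:
  obtains B where "B > 0" "\<And>z. z \<in> strip \<Longrightarrow> \<bar>1 / a z\<bar> \<le> B"
proof -
  have "continuous_on strip (\<lambda>z. 1 / a z)"
    by (intro continuous_intros C1_2pi_continuous[OF a_C1]) (use speed_nz in blast)
  moreover have "1 / a (x, t + 2 * pi) = 1 / a (x, t)" if "x \<in> {0..1}" for x t
    using C1_2pi_periodic[OF a_C1 that] by simp
  ultimately show ?thesis
    using strip_periodic_bounded that by blast
qed

text \<open>The difference of the reciprocals is the difference of the speeds times both
  reciprocals, and the reciprocals are bounded by compactness.\<close>

lemma slope_lipschitz:
  obtains L where "\<And>x t t'. x \<in> {0..1} \<Longrightarrow> \<bar>1 / a (x, t) - 1 / a (x, t')\<bar> \<le> L * \<bar>t - t'\<bar>"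
proof -
  obtain B where B: "B > 0" "\<And>z. z \<in> strip \<Longrightarrow> \<bar>1 / a z\<bar> \<le> B"
    using slope_bounded by blast
  obtain L where L: "L > 0" "\<And>x t t'. x \<in> {0..1} \<Longrightarrow> \<bar>a (x, t) - a (x, t')\<bar> \<le> L * \<bar>t - t'\<bar>"
    using C1_2pi_lipschitz[OF a_C1] by blast
  have "\<bar>1 / a (x, t) - 1 / a (x, t')\<bar> \<le> B * B * L * \<bar>t - t'\<bar>" if x: "x \<in> {0..1}" for x t t'
  proof -
    have "1 / a (x, t) - 1 / a (x, t') = 1 / a (x, t) * (1 / a (x, t')) * (a (x, t') - a (x, t))"
      using a_nz[OF x] by (simp add: field_simps)
    then have "\<bar>1 / a (x, t) - 1 / a (x, t')\<bar> = \<bar>1 / a (x, t)\<bar> * \<bar>1 / a (x, t')\<bar> * \<bar>a (x, t') - a (x, t)\<bar>"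
      by (simp only: abs_mult)
    also have "\<dots> \<le> B * B * (L * \<bar>t' - t\<bar>)"
      by (intro mult_mono) (use B x L in auto)
    finally show ?thesis by (simp add: abs_minus_commute mult_ac)
  qed
  then show ?thesis by (rule that)
qed

text \<open>This discharges the definite description in \<open>charac\<close> once and for all: flow
  identities below follow by exhibiting one curve that solves the equation with the right initial
  value.\<close>

lemma charac_eq:
  assumes w: "\<And>\<eta>. \<eta> \<in> {0..1} \<Longrightarrow> (w has_real_derivative 1 / a (\<eta>, w \<eta>)) (at \<eta> within {0..1})"
    and "x \<in> {0..1}" "\<xi> \<in> {0..1}" and "w x = t"
  shows "charac a \<xi> x t = w \<xi>"
  unfolding charac_def
proof (rule the_equality)
  show "\<exists>w'. (\<forall>\<eta>\<in>{0..1}. (w' has_real_derivative 1 / a (\<eta>, w' \<eta>)) (at \<eta> within {0..1})) \<and>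
      w' x = t \<and> w' \<xi> = w \<xi>"
    by (intro exI[of _ w] conjI ballI w assms(4) refl)
  obtain L where lip: "\<And>x t t'. x \<in> {0..1} \<Longrightarrow> \<bar>1 / a (x, t) - 1 / a (x, t')\<bar> \<le> L * \<bar>t - t'\<bar>"
    by (rule slope_lipschitz) blast
  fix y
  assume "\<exists>w'. (\<forall>\<eta>\<in>{0..1}. (w' has_real_derivative 1 / a (\<eta>, w' \<eta>)) (at \<eta> within {0..1})) \<and>
      w' x = t \<and> w' \<xi> = y"
  then obtain w' where
    w': "\<And>\<eta>. \<eta> \<in> {0..1} \<Longrightarrow> (w' has_real_derivative 1 / a (\<eta>, w' \<eta>)) (at \<eta> within {0..1})"
      "w' x = t" "w' \<xi> = y"
    by blast
  have "w' \<xi> = w \<xi>"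
    by (rule lipschitz_ode_unique[where F = "\<lambda>z. 1 / a z", OF lip w'(1) w \<open>x \<in> {0..1}\<close>])
      (simp_all only: assms w'(2))
  with w'(3) show "y = w \<xi>" by simp
qed

lemma charac_flow:
  obtains W where "continuous_on UNIV (\<lambda>(\<eta>, x, t). W \<eta> x t)"
    and "\<And>\<xi> x t. \<xi> \<in> {0..1} \<Longrightarrow> x \<in> {0..1} \<Longrightarrow> charac a \<xi> x t = W \<xi> x t"
    and "\<And>x t. W x x t = t"
    and "\<And>\<eta> x t. \<eta> \<in> {0..1} \<Longrightarrow>
      ((\<lambda>s. W s x t) has_real_derivative 1 / a (\<eta>, W \<eta> x t)) (at \<eta> within {0..1})"
proof -
  obtain B where B: "\<And>z. z \<in> strip \<Longrightarrow> \<bar>1 / a z\<bar> \<le> B"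
    by (rule slope_bounded) blast
  obtain L where L: "\<And>x t t'. x \<in> {0..1} \<Longrightarrow> \<bar>1 / a (x, t) - 1 / a (x, t')\<bar> \<le> L * \<bar>t - t'\<bar>"
    by (rule slope_lipschitz) blast
  \<comment> \<open>Clamping the space variable to [0,1] extends the slope to a bounded, continuous
    and Lipschitz field on the whole plane, as the flow construction requires, without changing it
    on the strip.\<close>
  define F where "F z = 1 / a (max 0 (min 1 (fst z)), snd z)" for z
  have cont: "continuous_on UNIV F"
    unfolding F_def
    by (intro continuous_intros continuous_on_compose2[OF C1_2pi_continuous[OF a_C1]])
      (auto simp: a_nz)
  have bnd: "\<bar>F z\<bar> \<le> B" for z
    unfolding F_def by (rule B) auto
  have lip: "\<bar>F (s, y) - F (s, y')\<bar> \<le> L * \<bar>y - y'\<bar>" for s y y'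
    unfolding F_def fst_conv snd_conv by (rule L) auto
  obtain W where W: "continuous_on UNIV (\<lambda>(\<eta>, x, t). W \<eta> x t)" "\<And>x t. W x x t = t"
    "\<And>\<eta> x t. ((\<lambda>s. W s x t) has_real_derivative F (\<eta>, W \<eta> x t)) (at \<eta>)"
    using lipschitz_flow_exists[OF cont bnd lip] by blast
  have d: "((\<lambda>s. W s x t) has_real_derivative 1 / a (\<eta>, W \<eta> x t)) (at \<eta> within {0..1})"
    if "\<eta> \<in> {0..1}" for \<eta> x t
    proof -
    have clamp: "max 0 (min 1 \<eta>) = \<eta>" using that by auto
    show ?thesis
      using has_field_derivative_at_within[OF W(3)[of x t \<eta>]]
      unfolding F_def fst_conv snd_conv clamp .
  qed
  show ?thesis
  proof (rule that[OF W(1) _ W(2) d])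
    show "charac a \<xi> x t = W \<xi> x t" if "\<xi> \<in> {0..1}" "x \<in> {0..1}" for \<xi> x t
      by (rule charac_eq[OF d]) (use that W(2) in auto)
  qed
qed

lemma charac_refl:
  assumes "x \<in> {0..1}"
  shows "charac a x x t = t"
proof -
  obtain W where "\<And>\<xi> x t. \<xi> \<in> {0..1} \<Longrightarrow> x \<in> {0..1} \<Longrightarrow> charac a \<xi> x t = W \<xi> x t"
    and "\<And>x t. W x x t = t"
    using charac_flow by metis
  then show ?thesis using assms by simp
qed

lemma charac_derivative:
  assumes "x \<in> {0..1}" "\<eta> \<in> {0..1}"
  shows "((\<lambda>\<eta>. charac a \<eta> x t) has_real_derivative 1 / a (\<eta>, charac a \<eta> x t)) (at \<eta> within {0..1})"
proof -
  obtain W where W: "\<And>\<xi> x t. \<xi> \<in> {0..1} \<Longrightarrow> x \<in> {0..1} \<Longrightarrow> charac a \<xi> x t = W \<xi> x t"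
    and d: "\<And>\<eta> x t. \<eta> \<in> {0..1} \<Longrightarrow>
      ((\<lambda>s. W s x t) has_real_derivative 1 / a (\<eta>, W \<eta> x t)) (at \<eta> within {0..1})"
    using charac_flow by metis
  have "((\<lambda>\<eta>. charac a \<eta> x t) has_real_derivative 1 / a (\<eta>, W \<eta> x t)) (at \<eta> within {0..1})"
    by (rule has_field_derivative_transform_within[OF d[OF assms(2)] zero_less_one assms(2)])
      (simp only: W assms(1))
  then show ?thesis
    by (simp only: W assms)
qed

text \<open>The characteristic through \<open>(x, t)\<close> is also the one through any other of
  its points.\<close>

lemma charac_compose:
  assumes "\<xi> \<in> {0..1}" "\<eta> \<in> {0..1}" "x \<in> {0..1}"
  shows "charac a \<xi> \<eta> (charac a \<eta> x t) = charac a \<xi> x t"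
  by (rule charac_eq[OF charac_derivative]) (use assms in auto)

text \<open>By periodicity of \<open>a\<close>, a characteristic shifted by one period is again a
  characteristic.\<close>

lemma charac_periodic:
  assumes "\<xi> \<in> {0..1}" "x \<in> {0..1}"
  shows "charac a \<xi> x (t + 2 * pi) = charac a \<xi> x t + 2 * pi"
proof (rule charac_eq)
  show "((\<lambda>\<eta>. charac a \<eta> x t + 2 * pi) has_real_derivative
      1 / a (\<eta>, charac a \<eta> x t + 2 * pi)) (at \<eta> within {0..1})" if "\<eta> \<in> {0..1}" for \<eta>
    using that assms C1_2pi_periodic[OF a_C1 that]
    by (auto intro!: derivative_eq_intros charac_derivative)
qed (use assms charac_refl in auto)

lemma continuous_on_charac:
  assumes "continuous_on S f" "continuous_on S g" "continuous_on S h"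
    and "\<And>z. z \<in> S \<Longrightarrow> f z \<in> {0..1}" "\<And>z. z \<in> S \<Longrightarrow> g z \<in> {0..1}"
  shows "continuous_on S (\<lambda>z. charac a (f z) (g z) (h z))"
proof -
  obtain W where W: "continuous_on UNIV (\<lambda>(\<eta>, x, t). W \<eta> x t)"
    "\<And>\<xi> x t. \<xi> \<in> {0..1} \<Longrightarrow> x \<in> {0..1} \<Longrightarrow> charac a \<xi> x t = W \<xi> x t"
    using charac_flow by metis
  have "continuous_on S (\<lambda>z. W (f z) (g z) (h z))"
    using continuous_on_compose2[OF W(1), of S "\<lambda>z. (f z, g z, h z)"] assms
    by (simp add: continuous_on_Pair)
  then show ?thesis
    by (rule continuous_on_eq) (use W(2) assms in auto)
qed

section \<open>Exponential weights along characteristics\<close>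

lemma cweight_eq:
  assumes b: "continuous_on strip b" and x: "x \<in> {0..1}" and \<xi>: "\<xi> \<in> {0..1}"
  shows "cweight a b \<xi> x t = exp ((\<xi> - x) * integral {0..1} (\<lambda>r.
      b (x + r * (\<xi> - x), charac a (x + r * (\<xi> - x)) x t) /
      a (x + r * (\<xi> - x), charac a (x + r * (\<xi> - x)) x t)))"
proof -
  define g where "g s = b (s, charac a s x t) / a (s, charac a s x t)" for s
  \<comment> \<open>The clamp makes the integrand continuous on the whole line; the segment between
    \<open>x\<close> and \<open>\<xi>\<close> lies in [0,1], where the clamp is the
    identity.\<close>
  define c where "c s = max 0 (min 1 s)" for s :: real
  have c: "c s \<in> {0..1}" "s \<in> {0..1} \<Longrightarrow> c s = s" for s
    by (auto simp: c_def)
  have x01: "0 \<le> x" "x \<le> 1"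
    using x by auto
  have g: "continuous_on UNIV (\<lambda>s. g (c s))"
    unfolding g_def c_def
    by (intro continuous_intros continuous_on_compose2[OF C1_2pi_continuous[OF a_C1]]
        continuous_on_compose2[OF b] continuous_on_charac) (auto simp: a_nz x01)
  have "(LBINT s=ereal x..ereal \<xi>. g s) = (LBINT s=ereal x..ereal \<xi>. g (c s))"
    by (rule interval_integral_cong) (use x \<xi> c(2) in \<open>auto simp: einterval_def min_def max_def split: if_splits\<close>)
  also have "\<dots> = (\<xi> - x) * integral {0..1} (\<lambda>r. g (c (x + r * (\<xi> - x))))"
    by (rule interval_integral_rescaled[OF g])
  also have "integral {0..1} (\<lambda>r. g (c (x + r * (\<xi> - x)))) = integral {0..1} (\<lambda>r. g (x + r * (\<xi> - x)))"
    by (intro integral_cong) (simp only: c(2) convex_combination_unit_interval[OF x \<xi>])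
  finally show ?thesis
    unfolding cweight_def g_def by simp
qed

text \<open>After rescaling, the domain of integration no longer depends on the base point, so
  continuity of parameter integrals applies.\<close>

lemma continuous_on_cweight:
  assumes b: "continuous_on strip b" and \<xi>: "\<xi> \<in> {0..1}"
  shows "continuous_on strip (\<lambda>z. cweight a b \<xi> (fst z) (snd z))"
proof -
  define H where "H z r = b (fst z + r * (\<xi> - fst z), charac a (fst z + r * (\<xi> - fst z)) (fst z) (snd z)) /
      a (fst z + r * (\<xi> - fst z), charac a (fst z + r * (\<xi> - fst z)) (fst z) (snd z))" for z r
  have strip: "fst z + r * (\<xi> - fst z) \<in> {0..1}" if "z \<in> strip" "r \<in> {0..1}" for z r
    by (rule convex_combination_unit_interval) (use that \<xi> in \<open>auto simp: strip_def\<close>)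
  have "continuous_on (strip \<times> cbox 0 1) (\<lambda>(z, r). H z r)"
    unfolding H_def case_prod_beta
  proof (intro continuous_intros continuous_on_compose2[OF C1_2pi_continuous[OF a_C1]]
        continuous_on_compose2[OF b] continuous_on_charac)
  qed (use strip a_nz in \<open>auto simp: strip_def\<close>)
  from integral_continuous_on_param[OF this]
  have "continuous_on strip (\<lambda>z. exp ((\<xi> - fst z) * integral {0..1} (H z)))"
    by (auto intro!: continuous_intros)
  then show ?thesis
  proof (rule continuous_on_eq)
    fix z assume "z \<in> strip"
    then have "fst z \<in> {0..1}" by (auto simp: strip_def)
    then show "exp ((\<xi> - fst z) * integral {0..1} (H z)) = cweight a b \<xi> (fst z) (snd z)"
      unfolding H_def[abs_def] by (simp only: cweight_eq[OF b _ \<xi>])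
  qed
qed

lemma cweight_periodic:
  assumes b: "continuous_on strip b" "\<And>x t. x \<in> {0..1} \<Longrightarrow> b (x, t + 2 * pi) = b (x, t)"
    and "\<xi> \<in> {0..1}" "x \<in> {0..1}"
  shows "cweight a b \<xi> x (t + 2 * pi) = cweight a b \<xi> x t"
proof -
  have "integral {0..1} (\<lambda>r.
      b (x + r * (\<xi> - x), charac a (x + r * (\<xi> - x)) x (t + 2 * pi)) /
      a (x + r * (\<xi> - x), charac a (x + r * (\<xi> - x)) x (t + 2 * pi))) =
    integral {0..1} (\<lambda>r.
      b (x + r * (\<xi> - x), charac a (x + r * (\<xi> - x)) x t) /
      a (x + r * (\<xi> - x), charac a (x + r * (\<xi> - x)) x t))"
    by (intro integral_cong)
      (simp only: charac_periodic convex_combination_unit_interval[OF assms(4,3)] assms(4) b(2) C1_2pi_periodic[OF a_C1])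
  then show ?thesis
    by (simp only: cweight_eq[OF b(1) assms(4,3)])
qed

end

subsection \<open>Contractions and inverse matrices\<close>

text \<open>The hypothesis contracts the maximum norm, while the distance on bounded continuous
  functions uses the Euclidean norm. Passing between them costs at most a factor
  \<open>CARD('n)\<close>, which a high power \<open>q ^ N\<close> absorbs, so the iterate
  \<open>T ^^ N\<close> is a contraction.\<close>

lemma componentwise_contraction_fixed_point:
  fixes T :: "('a::metric_space \<Rightarrow>\<^sub>C (real ^ 'n)) \<Rightarrow> ('a \<Rightarrow>\<^sub>C (real ^ 'n))"
  assumes q: "0 \<le> q" "q < 1"
    and T: "\<And>u v B s j. (\<And>t k. \<bar>apply_bcontfun u t $ k - apply_bcontfun v t $ k\<bar> \<le> B) \<Longrightarrow>
      \<bar>apply_bcontfun (T u) s $ j - apply_bcontfun (T v) s $ j\<bar> \<le> q * B"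
  shows "\<exists>!u. T u = u"
proof -
  obtain N where N: "q ^ N < 1 / CARD('n)"
    using real_arch_pow_inv[of "1 / CARD('n)" q] q by auto
  have iter: "\<bar>(T ^^ i) u s $ j - (T ^^ i) v s $ j\<bar> \<le> q ^ i * dist u v" for i u v s j
  proof (induction i arbitrary: s j)
    case 0
    have "\<bar>u s $ j - v s $ j\<bar> \<le> norm (u s - v s)"
      using component_le_norm_cart[of "u s - v s" j] by simp
    also have "\<dots> \<le> dist u v"
      using dist_bounded[of u s v] by (simp add: dist_norm)
    finally show ?case by simp
  next
    case (Suc i)
    show ?case
      using T[of "(T ^^ i) u" "(T ^^ i) v", OF Suc.IH] by (simp add: mult.assoc)
  qed
  have contr: "dist ((T ^^ N) u) ((T ^^ N) v) \<le> real CARD('n) * q ^ N * dist u v" for u v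
  proof (rule dist_bound)
    fix s
    have "dist ((T ^^ N) u s) ((T ^^ N) v s) \<le> (\<Sum>j\<in>UNIV. \<bar>(T ^^ N) u s $ j - (T ^^ N) v s $ j\<bar>)"
      using norm_le_l1_cart[of "(T ^^ N) u s - (T ^^ N) v s"] by (simp add: dist_norm)
    also have "\<dots> \<le> (\<Sum>j\<in>(UNIV :: 'n set). q ^ N * dist u v)"
      by (intro sum_mono iter)
    finally show "dist ((T ^^ N) u s) ((T ^^ N) v s) \<le> real CARD('n) * q ^ N * dist u v"
      by simp
  qed
  have "real CARD('n) * q ^ N < 1"
    using N by (simp add: field_simps)
  then have "\<exists>!u. (T ^^ N) u = u"
    by (intro banach_fix_type[of "real CARD('n) * q ^ N"]) (use q contr in auto)
  then obtain u where u: "(T ^^ N) u = u" "\<And>v. (T ^^ N) v = v \<Longrightarrow> v = u"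
    by blast
  show ?thesis
  proof (rule ex1I[of _ u])
    \<comment> \<open>\<open>T\<close> commutes with its iterates, so it maps the unique fixed point
      of \<open>T ^^ N\<close> to a fixed point of \<open>T ^^ N\<close>, hence to itself.\<close>
    have "(T ^^ N) (T u) = T u"
      using u(1) by (simp flip: funpow_swap1)
    then show "T u = u" by (rule u(2))
    fix v assume v: "T v = v"
    have "(T ^^ i) v = v" for i
      by (induction i) (auto simp: v)
    then show "v = u" by (rule u(2))
  qed
qed

section \<open>Inverse matrices: continuity and row-sum bounds\<close>

lemma matrix_inv_mult:
  fixes A :: "real ^ 'n ^ 'n"
  assumes "invertible A"
  shows "A ** matrix_inv A = mat 1" "matrix_inv A ** A = mat 1"
  using someI_ex[of "\<lambda>B. A ** B = mat 1 \<and> B ** A = mat 1"] assms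
  unfolding invertible_def matrix_inv_def by blast+

lemma continuous_on_det:
  fixes A :: "'a::topological_space \<Rightarrow> real ^ 'n ^ 'n"
  assumes "continuous_on S A"
  shows "continuous_on S (\<lambda>t. det (A t))"
  unfolding det_def using assms by (intro continuous_intros)

text \<open>Cramer's rule, applied to the columns of the inverse, writes each entry as a quotient of
  determinants with nonvanishing denominator.\<close>

lemma continuous_on_matrix_inv:
  fixes A :: "'a::topological_space \<Rightarrow> real ^ 'n ^ 'n"
  assumes A: "continuous_on S A" and inv: "\<And>t. t \<in> S \<Longrightarrow> invertible (A t)"
  shows "continuous_on S (\<lambda>t. matrix_inv (A t))"
proof -
  have d: "det (A t) \<noteq> 0" if "t \<in> S" for t
    using inv[OF that] by (simp add: invertible_det_nz)
  have cramer: "matrix_inv (A t) $ j $ k =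
      det (\<chi> i l. if l = j then axis k 1 $ i else A t $ i $ l) / det (A t)" if "t \<in> S" for t j k
  proof -
    have "A t *v (matrix_inv (A t) *v axis k 1) = axis k 1"
      by (simp add: matrix_vector_mul_assoc matrix_inv_mult inv that)
    from this[unfolded cramer[OF d[OF that]]]
    have "(matrix_inv (A t) *v axis k 1) $ j =
        det (\<chi> i l. if l = j then axis k 1 $ i else A t $ i $ l) / det (A t)"
      by simp
    then show ?thesis
      by (simp add: matrix_vector_mult_basis column_def)
  qed
  have "continuous_on S (\<lambda>t. if l = j then c else A t $ i $ l)" for l j i c
    by (cases "l = j") (auto intro!: continuous_intros A)
  then have "continuous_on S (\<lambda>t. matrix_inv (A t) $ j $ k)" for j k
    by (subst continuous_on_cong[OF refl cramer])
      (auto intro!: continuous_intros continuous_on_det A d)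
  then have "continuous_on S (\<lambda>t. \<chi> j k. matrix_inv (A t) $ j $ k)"
    by (intro continuous_on_vec_lambda)
  then show ?thesis by simp
qed

lemma row_sum_le_mat_norm_inf: "(\<Sum>k\<in>UNIV. \<bar>M $ j $ k\<bar>) \<le> mat_norm_inf M"
  unfolding mat_norm_inf_def by (rule Max_ge) auto

lemma matrix_vector_component_bound:
  fixes M :: "real ^ 'n ^ 'm"
  assumes x: "\<And>k. \<bar>x $ k\<bar> \<le> B" and q: "(\<Sum>k\<in>UNIV. \<bar>M $ j $ k\<bar>) \<le> q"
  shows "\<bar>(M *v x) $ j\<bar> \<le> q * B"
proof -
  have "B \<ge> 0" using x[of undefined] by linarith
  have "\<bar>(M *v x) $ j\<bar> \<le> (\<Sum>k\<in>UNIV. \<bar>M $ j $ k * x $ k\<bar>)"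
    unfolding matrix_vector_mult_def by (simp add: sum_abs)
  also have "\<dots> \<le> (\<Sum>k\<in>UNIV. \<bar>M $ j $ k\<bar> * B)"
    unfolding abs_mult by (intro sum_mono mult_left_mono x) auto
  also have "\<dots> \<le> q * B"
    using mult_right_mono[OF q \<open>B \<ge> 0\<close>] by (simp add: sum_distrib_right)
  finally show ?thesis .
qed

section \<open>Periodic continuous functions as bounded continuous functions\<close>

lemma periodic_bcontfun:
  fixes f :: "real \<Rightarrow> 'a::metric_space"
  assumes cont: "continuous_on UNIV f" and per: "\<And>t. f (t + 2 * pi) = f t"
  shows "f \<in> bcontfun"
proof -
  have "f t \<in> f ` {0..2 * pi}" for t
    using periodic_representative[of f t, OF per] by (metis imageI)
  then have "range f \<subseteq> f ` {0..2 * pi}" by blast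
  moreover have "compact (f ` {0..2 * pi})"
    by (intro compact_continuous_image continuous_on_subset[OF cont]) auto
  ultimately show ?thesis
    unfolding bcontfun_def using cont compact_imp_bounded bounded_subset by blast
qed

lemma C_n2pi_continuous: "v \<in> C_n2pi \<Longrightarrow> continuous_on strip v"
  unfolding C_n2pi_def by blast

lemma C_n2pi_continuous_section:
  assumes "v \<in> C_n2pi" "x \<in> {0..1}"
  shows "continuous_on S (\<lambda>t. v (x, t))"
proof (rule continuous_on_compose2[OF C_n2pi_continuous[OF assms(1)]])
  show "(\<lambda>t. (x, t)) ` S \<subseteq> strip"
    using assms(2) by auto
qed (intro continuous_intros)

lemma C_n2pi_add: "u \<in> C_n2pi \<Longrightarrow> v \<in> C_n2pi \<Longrightarrow> (\<lambda>z. u z + v z) \<in> C_n2pi"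
  and C_n2pi_diff: "u \<in> C_n2pi \<Longrightarrow> v \<in> C_n2pi \<Longrightarrow> (\<lambda>z. u z - v z) \<in> C_n2pi"
  unfolding C_n2pi_def by (simp_all add: continuous_on_add continuous_on_diff)

subsection \<open>The reflection operator\<close>

locale reflection_problem =
  fixes \<iota> :: "'n::finite \<Rightarrow> nat"
    and m :: nat
    and a b :: "'n \<Rightarrow> real \<times> real \<Rightarrow> real"
    and p :: "'n \<Rightarrow> 'n \<Rightarrow> real \<Rightarrow> real"
  assumes char: "\<And>j. characteristic (a j)"
    and b_C1: "\<And>j. b j \<in> C1_2pi"
    and p_C: "\<And>j k. p j k \<in> C_2pi"
    and Q_inv: "\<And>t. invertible (Qmat \<iota> m a b p t)"
    and Q_norm: "\<And>t. mat_norm_inf (matrix_inv (Qmat \<iota> m a b p t)) < 1"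
begin

abbreviation "x_in \<equiv> inflow \<iota> m"
abbreviation "x_out j \<equiv> 1 - inflow \<iota> m j"
abbreviation "Q \<equiv> Qmat \<iota> m a b p"
text \<open>Entry and exit refer to the ends \<open>x_in j\<close> and \<open>x_out j\<close> of the
  strip. They are not an order in time: a negative speed makes the exit time the earlier
  one.\<close>

abbreviation "exit_time j \<equiv> charac (a j) (x_out j) (x_in j)"
abbreviation "entry_time j \<equiv> charac (a j) (x_in j) (x_out j)"

lemma x_in [simp]: "x_in j \<in> {0..1}" "x_out j \<in> {0..1}"
  "0 \<le> x_in j" "x_in j \<le> 1" "0 \<le> x_out j" "x_out j \<le> 1"
  by (auto simp: inflow_def)

lemma exit_entry: "exit_time j (entry_time j t) = t" "entry_time j (exit_time j t) = t"
  by (simp_all add: characteristic.charac_compose[OF char] characteristic.charac_refl[OF char]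
      del: atLeastAtMost_iff)

lemma exit_periodic: "exit_time j (t + 2 * pi) = exit_time j t + 2 * pi"
  by (simp add: characteristic.charac_periodic[OF char] del: atLeastAtMost_iff)

lemma continuous_on_exit: "continuous_on S (exit_time j)"
  by (intro characteristic.continuous_on_charac[OF char] continuous_intros) auto

text \<open>Both cases in \<open>Qmat\<close> are the same expression once the two ends of the strip
  are named by their role.\<close>

lemma Q_entry: "Q t $ j $ k = cweight (a j) (b j) (x_in j) (x_out j) (exit_time j t) * p j k t"
  by (simp add: Qmat_def inflow_def)

lemma b_continuous: "continuous_on strip (b j)"
  and b_periodic: "x \<in> {0..1} \<Longrightarrow> b j (x, t + 2 * pi) = b j (x, t)"
  using C1_2pi_continuous[OF b_C1] C1_2pi_periodic[OF b_C1] by auto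

lemma p_continuous: "continuous_on S f \<Longrightarrow> continuous_on S (\<lambda>z. p j k (f z))"
  and p_periodic: "p j k (t + 2 * pi) = p j k t"
  using p_C[of j k] unfolding C_2pi_def by (auto intro: continuous_on_compose2)

lemma continuous_on_weight:
  assumes "continuous_on S f" "continuous_on S g" "\<And>z. z \<in> S \<Longrightarrow> f z \<in> {0..1}"
  shows "continuous_on S (\<lambda>z. cweight (a j) (b j) (x_in j) (f z) (g z))"
  using continuous_on_compose2[OF characteristic.continuous_on_cweight[OF char b_continuous x_in(1)],
      of S "\<lambda>z. (f z, g z)"] assms
  by (force intro: continuous_on_Pair)

lemma weight_periodic: "x \<in> {0..1} \<Longrightarrow>
    cweight (a j) (b j) (x_in j) x (t + 2 * pi) = cweight (a j) (b j) (x_in j) x t"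
  by (intro characteristic.cweight_periodic[OF char] b_continuous b_periodic x_in(1))

lemma Q_continuous: "continuous_on UNIV Q"
proof -
  have "continuous_on UNIV (\<lambda>t. \<chi> j k. Q t $ j $ k)"
    unfolding Q_entry
    by (intro continuous_intros continuous_on_weight continuous_on_exit p_continuous) auto
  then show ?thesis by simp
qed

lemma Q_periodic: "Q (t + 2 * pi) = Q t"
  by (simp add: vec_eq_iff Q_entry exit_periodic weight_periodic p_periodic del: atLeastAtMost_iff)

text \<open>A pointwise bound below 1 becomes uniform because each row sum is continuous and
  periodic, hence attains its supremum on one period, and there are finitely many rows.\<close>

lemma inverse_uniform_contraction:
  obtains q where "0 \<le> q" "q < 1" "\<And>t j. (\<Sum>k\<in>UNIV. \<bar>matrix_inv (Q t) $ j $ k\<bar>) \<le> q"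
proof -
  define r where "r j t = (\<Sum>k\<in>UNIV. \<bar>matrix_inv (Q t) $ j $ k\<bar>)" for j t
  have "\<exists>q<1. \<forall>t. r j t \<le> q" for j
  proof -
    have "continuous_on {0..2 * pi} (r j)"
      unfolding r_def
      by (intro continuous_intros continuous_on_matrix_inv Q_inv continuous_on_subset[OF Q_continuous]) auto
    then have "\<exists>s\<in>{0..2 * pi}. \<forall>t\<in>{0..2 * pi}. r j t \<le> r j s"
      by (intro continuous_attains_sup) auto
    then obtain s where s: "\<And>t. t \<in> {0..2 * pi} \<Longrightarrow> r j t \<le> r j s"
      by blast
    have "r j t \<le> r j s" for t
      using periodic_representative[of "r j" t] s by (metis r_def Q_periodic)
    moreover have "r j s < 1"
      using row_sum_le_mat_norm_inf Q_norm unfolding r_def by (rule le_less_trans)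
    ultimately show ?thesis by blast
  qed
  then obtain q where q: "\<And>j. q j < 1" "\<And>j t. r j t \<le> q j"
    by metis
  have r_nonneg: "0 \<le> r j t" for j t
    unfolding r_def by (intro sum_nonneg) auto
  have le: "q j \<le> Max (range q)" for j
    by (intro Max_ge) auto
  show ?thesis
  proof (rule that[of "Max (range q)"])
    show "0 \<le> Max (range q)"
      using r_nonneg q(2) le by (meson order_trans)
    show "Max (range q) < 1"
      using q(1) by (subst Max_less_iff) auto
    show "(\<Sum>k\<in>UNIV. \<bar>matrix_inv (Q t) $ j $ k\<bar>) \<le> Max (range q)" for t j
      using order_trans[OF q(2) le, of j t] unfolding r_def .
  qed
qed

section \<open>Reduction to the outflow traces\<close>

definition out_trace :: "(real \<times> real \<Rightarrow> real ^ 'n) \<Rightarrow> real \<Rightarrow> real ^ 'n" where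
  "out_trace v t = (\<chi> k. v (x_out k, t) $ k)"

text \<open>This is the reflection operator with the traces of \<open>v\<close> replaced by an
  arbitrary function \<open>y\<close> of time, so that the operator factors as
  \<open>transport\<close> after \<open>out_trace\<close>.\<close>

definition transport :: "(real \<Rightarrow> real ^ 'n) \<Rightarrow> real \<times> real \<Rightarrow> real ^ 'n" where
  "transport y = (\<lambda>(x, t). if (x, t) \<in> strip then
      (\<chi> j. cweight (a j) (b j) (x_in j) x t *
        (\<Sum>k\<in>UNIV. p j k (charac (a j) (x_in j) x t) * y (charac (a j) (x_in j) x t) $ k))
    else 0)"

lemma reflection_op_eq: "reflection_op \<iota> m a b p v = transport (out_trace v)"
  by (auto simp: reflection_op_def transport_def out_trace_def fun_eq_iff)

lemma out_trace_bcontfun: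
  assumes "v \<in> C_n2pi"
  shows "out_trace v \<in> bcontfun"
    and "out_trace v (t + 2 * pi) = out_trace v t"
proof -
  show per: "out_trace v (t + 2 * pi) = out_trace v t" for t
    using assms x_in unfolding out_trace_def C_n2pi_def by (auto simp: vec_eq_iff)
  show "out_trace v \<in> bcontfun"
    by (rule periodic_bcontfun[where f = "out_trace v", OF _ per])
      (auto simp: out_trace_def intro!: continuous_intros C_n2pi_continuous_section assms)
qed

lemma transport_C_n2pi:
  assumes y: "continuous_on UNIV y" "\<And>t. y (t + 2 * pi) = y t"
  shows "transport y \<in> C_n2pi"
proof -
  have char_cont: "continuous_on strip (\<lambda>z. charac (a j) (x_in j) (fst z) (snd z))" for j
    by (intro characteristic.continuous_on_charac[OF char] continuous_intros) (auto simp: strip_def)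
  have "continuous_on strip (\<lambda>z. (\<chi> j. cweight (a j) (b j) (x_in j) (fst z) (snd z) *
        (\<Sum>k\<in>UNIV. p j k (charac (a j) (x_in j) (fst z) (snd z)) *
          y (charac (a j) (x_in j) (fst z) (snd z)) $ k)))"
    by (intro continuous_intros continuous_on_weight p_continuous char_cont
        continuous_on_compose2[OF y(1)]) (auto simp: strip_def)
  then have "continuous_on strip (transport y)"
    by (rule continuous_on_eq) (auto simp: transport_def)
  moreover have "transport y (x, t + 2 * pi) = transport y (x, t)" if x: "x \<in> {0..1}" for x t
    using x by (simp add: transport_def vec_eq_iff weight_periodic p_periodic y(2)
        characteristic.charac_periodic[OF char])
  moreover have "transport y z = 0" if "z \<notin> strip" for z
    using that by (auto simp: transport_def split: prod.split)
  ultimately show ?thesis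
    unfolding C_n2pi_def by blast
qed

text \<open>The characteristic that leaves at \<open>exit_time j s\<close> entered at
  \<open>s\<close>. Hence \<open>p\<close> and \<open>y\<close> are evaluated at the same time
  \<open>s\<close> for every row \<open>j\<close>, and the rows assemble into one matrix
  product.\<close>

lemma trace_transport_exit: "out_trace (transport y) (exit_time j s) $ j = (Q s *v y s) $ j"
  by (simp add: out_trace_def transport_def exit_entry Q_entry matrix_vector_mult_def
      sum_distrib_left mult.assoc)

section \<open>Solving the trace equation\<close>

definition pullback :: "(real \<Rightarrow> real ^ 'n) \<Rightarrow> real \<Rightarrow> real ^ 'n" where
  "pullback y s = (\<chi> j. y (exit_time j s) $ j)"

text \<open>Following every characteristic from its inflow to its outflow end turns the trace equation
  into \<open>y (exit) = Q y + g\<close>; solving for the undelayed \<open>y\<close> makes \<open>Q\<^sup>-\<^sup>1\<close> the contraction factor.\<close>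

lemma trace_equation_iff:
  "y = (\<lambda>t. out_trace (transport y) t + g t) \<longleftrightarrow>
    y = (\<lambda>s. matrix_inv (Q s) *v (pullback y s - pullback g s))"
proof -
  have "y = (\<lambda>t. out_trace (transport y) t + g t) \<longleftrightarrow>
      (\<forall>j t. y t $ j = out_trace (transport y) t $ j + g t $ j)"
    by (auto simp: fun_eq_iff vec_eq_iff)
  \<comment> \<open>Each \<open>exit_time j\<close> is onto, with \<open>entry_time j\<close> as
    inverse, so every time may be written as an exit time, separately in each component.\<close>
  also have "\<dots> \<longleftrightarrow> (\<forall>j s. y (exit_time j s) $ j =
      out_trace (transport y) (exit_time j s) $ j + g (exit_time j s) $ j)"
    using exit_entry(1) by metis
  also have "\<dots> \<longleftrightarrow> (\<forall>s. Q s *v y s = pullback y s - pullback g s)"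
    by (auto simp: trace_transport_exit pullback_def vec_eq_iff algebra_simps)
  also have "\<dots> \<longleftrightarrow> (\<forall>s. y s = matrix_inv (Q s) *v (pullback y s - pullback g s))"
  proof -
    have "Q s *v u = w \<longleftrightarrow> u = matrix_inv (Q s) *v w" for s u w
    proof -
      have "matrix_inv (Q s) *v (Q s *v u) = u" "Q s *v (matrix_inv (Q s) *v w) = w"
        by (simp_all add: matrix_vector_mul_assoc matrix_inv_mult Q_inv)
      then show ?thesis by metis
    qed
    then show ?thesis by simp
  qed
  finally show ?thesis by (simp add: fun_eq_iff)
qed

text \<open>The contraction is run on all bounded continuous functions; periodicity of the solution
  is recovered later from uniqueness.\<close>

lemma trace_equation_unique_solution:
  assumes g: "g \<in> bcontfun"
  shows "\<exists>!u :: real \<Rightarrow>\<^sub>C (real ^ 'n).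
    apply_bcontfun u = (\<lambda>t. out_trace (transport u) t + g t)"
proof -
  obtain q where q: "0 \<le> q" "q < 1" "\<And>t j. (\<Sum>k\<in>UNIV. \<bar>matrix_inv (Q t) $ j $ k\<bar>) \<le> q"
    using inverse_uniform_contraction by blast
  obtain g' where g': "g = apply_bcontfun g'"
    using g by (rule bcontfunE)
  define P where "P y s = matrix_inv (Q s) *v (pullback y s - pullback g s)" for y s
  have pullback_cont: "continuous_on UNIV (pullback (apply_bcontfun u))" for u
    unfolding pullback_def
    by (intro continuous_intros continuous_on_compose2[OF continuous_on_apply_bcontfun[of UNIV]]
        continuous_on_exit) auto
  have pullback_bound: "\<bar>pullback (apply_bcontfun u) s $ j\<bar> \<le> norm u" for u s j
    unfolding pullback_def using component_le_norm_cart norm_bounded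
    by (metis (no_types, lifting) order_trans vec_lambda_beta)
  have P_mem: "P (apply_bcontfun u) \<in> bcontfun" for u
  proof (rule bcontfun_normI)
    have "continuous_on UNIV (\<lambda>s. \<chi> j. \<Sum>k\<in>UNIV. matrix_inv (Q s) $ j $ k *
        (pullback (apply_bcontfun u) s - pullback g s) $ k)"
      unfolding g'
      by (intro continuous_intros continuous_on_matrix_inv Q_continuous Q_inv pullback_cont)
    then show "continuous_on UNIV (P (apply_bcontfun u))"
      by (simp add: P_def[abs_def] matrix_vector_mult_def)
    fix s
    have "\<bar>(pullback (apply_bcontfun u) s - pullback g s) $ k\<bar> \<le> norm u + norm g'" for k
      using pullback_bound[of u s k] pullback_bound[of g' s k] by (simp add: g')
    then have "\<bar>P (apply_bcontfun u) s $ j\<bar> \<le> q * (norm u + norm g')" for j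
      unfolding P_def by (rule matrix_vector_component_bound) (rule q(3))
    then have "(\<Sum>j\<in>UNIV. \<bar>P (apply_bcontfun u) s $ j\<bar>) \<le> (\<Sum>j\<in>(UNIV :: 'n set). q * (norm u + norm g'))"
      by (rule sum_mono)
    with norm_le_l1_cart
    show "norm (P (apply_bcontfun u) s) \<le> (\<Sum>j\<in>(UNIV :: 'n set). q * (norm u + norm g'))"
      by (rule order_trans)
  qed
  define T where "T u = Bcontfun (P (apply_bcontfun u))" for u
  have T_apply: "apply_bcontfun (T u) = P (apply_bcontfun u)" for u
    unfolding T_def by (rule Bcontfun_inverse[OF P_mem])
  have "\<exists>!u. T u = u"
  proof (rule componentwise_contraction_fixed_point[OF q(1,2)])
    fix u v :: "real \<Rightarrow>\<^sub>C (real ^ 'n)" and B s j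
    assume B: "\<And>t k. \<bar>u t $ k - v t $ k\<bar> \<le> B"
    \<comment> \<open>The inhomogeneity cancels, and \<open>pullback\<close> only resamples each
      component, so it preserves the bound \<open>B\<close>; the row sums of the inverse supply the
      factor \<open>q\<close>.\<close>
    have "T u s - T v s = matrix_inv (Q s) *v (pullback u s - pullback v s)"
      by (simp add: T_apply P_def flip: matrix_vector_mult_diff_distrib)
    moreover have "\<bar>(pullback u s - pullback v s) $ k\<bar> \<le> B" for k
      by (simp add: pullback_def B)
    ultimately have "\<bar>(T u s - T v s) $ j\<bar> \<le> q * B"
      using q(3) by (simp add: matrix_vector_component_bound)
    then show "\<bar>T u s $ j - T v s $ j\<bar> \<le> q * B" by simp
  qed
  moreover have "T u = u \<longleftrightarrow> apply_bcontfun u = (\<lambda>t. out_trace (transport u) t + g t)" for u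
    unfolding trace_equation_iff using T_apply[of u]
    by (metis (no_types, lifting) P_def apply_bcontfun_inject ext)
  ultimately show ?thesis by simp
qed

section \<open>From traces back to functions on the strip\<close>

lemma reflection_op_C_n2pi:
  assumes "v \<in> C_n2pi"
  shows "reflection_op \<iota> m a b p v \<in> C_n2pi"
  unfolding reflection_op_eq
  by (rule transport_C_n2pi) (use out_trace_bcontfun[OF assms] in \<open>auto simp: bcontfun_def\<close>)

lemma out_trace_add: "out_trace (\<lambda>z. u z + v z) = (\<lambda>t. out_trace u t + out_trace v t)"
  by (simp add: out_trace_def fun_eq_iff vec_eq_iff)

lemma transport_shift:
  assumes "x \<in> {0..1}"
  shows "transport (\<lambda>t. y (t + 2 * pi)) (x, t) = transport y (x, t + 2 * pi)"
  using assms by (simp add: transport_def vec_eq_iff weight_periodic p_periodic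
      characteristic.charac_periodic[OF char])

text \<open>A solution is determined by its trace, since
  \<open>v = transport (out_trace v) + f\<close>, and taking traces of this identity gives the trace
  equation. Conversely, the trace solution \<open>u\<close> generates
  \<open>v = transport u + f\<close>, whose trace is \<open>u\<close> again.\<close>

lemma reflection_equation_unique_solution:
  assumes f: "f \<in> C_n2pi"
  shows "\<exists>!v. v \<in> C_n2pi \<and> (\<lambda>z. v z - reflection_op \<iota> m a b p v z) = f"
proof -
  note g = out_trace_bcontfun[OF f]
  obtain u where u: "apply_bcontfun u = (\<lambda>t. out_trace (transport u) t + out_trace f t)"
    and uniq: "\<And>w. apply_bcontfun w = (\<lambda>t. out_trace (transport w) t + out_trace f t) \<Longrightarrow> w = u"
    using trace_equation_unique_solution[OF g(1)] by (metis (no_types, lifting))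
  \<comment> \<open>Shifting \<open>u\<close> by one period gives another bounded continuous
    solution, because the coefficients and the trace of \<open>f\<close> are periodic; uniqueness
    identifies the two.\<close>
  have u_per: "u (t + 2 * pi) = u t" for t
  proof -
    have mem: "(\<lambda>t. u (t + 2 * pi)) \<in> bcontfun"
    proof (rule bcontfun_normI)
      show "continuous_on UNIV (\<lambda>t. u (t + 2 * pi))"
        by (intro continuous_on_compose2[OF continuous_on_apply_bcontfun[of UNIV]] continuous_intros) auto
    qed (rule norm_bounded)
    then obtain w where w: "(\<lambda>t. u (t + 2 * pi)) = apply_bcontfun w"
      by (rule bcontfunE)
    have "u (t + 2 * pi) = out_trace (transport (\<lambda>t. u (t + 2 * pi))) t + out_trace f t" for t
    proof -
      have "u (t + 2 * pi) = out_trace (transport u) (t + 2 * pi) + out_trace f (t + 2 * pi)"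
        by (rule fun_cong[OF u])
      also have "out_trace (transport u) (t + 2 * pi) = out_trace (transport (\<lambda>t. u (t + 2 * pi))) t"
        by (simp only: out_trace_def transport_shift[OF x_in(2)])
      finally show ?thesis
        by (simp only: g(2))
    qed
    then have "apply_bcontfun w = (\<lambda>t. out_trace (transport w) t + out_trace f t)"
      unfolding w by (rule ext[OF trans[OF fun_cong[OF w[symmetric]]]])
    then have "w = u" by (rule uniq)
    then show ?thesis
      using fun_cong[OF w, of t] by simp
  qed
  define v where "v z = transport u z + f z" for z
  have v: "v \<in> C_n2pi"
    unfolding v_def by (intro C_n2pi_add transport_C_n2pi f u_per) auto
  have "out_trace v = u"
    unfolding v_def out_trace_add by (rule u[symmetric])
  show ?thesis
  proof (rule ex1I[of _ v])
    show "v \<in> C_n2pi \<and> (\<lambda>z. v z - reflection_op \<iota> m a b p v z) = f"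
      using v by (simp add: reflection_op_eq \<open>out_trace v = u\<close> v_def)
  next
    fix w assume w: "w \<in> C_n2pi \<and> (\<lambda>z. w z - reflection_op \<iota> m a b p w z) = f"
    then have *: "(\<lambda>z. w z - transport (out_trace w) z) = f"
      by (simp only: reflection_op_eq)
    have w_eq: "w = (\<lambda>z. transport (out_trace w) z + f z)"
      by (simp flip: *)
    obtain y where y: "out_trace w = apply_bcontfun y"
      using out_trace_bcontfun(1) w bcontfunE by blast
    have "apply_bcontfun y = (\<lambda>t. out_trace (transport y) t + out_trace f t)"
      using arg_cong[OF w_eq, of out_trace] unfolding out_trace_add y .
    then have "y = u" by (rule uniq)
    then have "v = (\<lambda>z. transport (out_trace w) z + f z)"
      by (simp add: v_def[abs_def] y)
    then show "w = v" by (rule trans[OF w_eq sym])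
  qed
qed

end

section \<open>Bijectivity of the identity minus the reflection operator\<close>

theorem mainTheorem4:
  fixes \<iota> :: "'n::finite \<Rightarrow> nat"
    and m :: nat
    and a b :: "'n \<Rightarrow> real \<times> real \<Rightarrow> real"
    and p :: "'n \<Rightarrow> 'n \<Rightarrow> real \<Rightarrow> real"
  assumes "bij_betw \<iota> UNIV {1..CARD('n)}"
    and "m \<le> CARD('n)"
    and "\<And>j. a j \<in> C1_2pi"
    and "\<And>j. b j \<in> C1_2pi"
    and "\<And>j x t. x \<in> {0..1} \<Longrightarrow> a j (x, t) \<noteq> 0"
    and "\<And>j k. p j k \<in> C_2pi"
    and "\<And>t. invertible (Qmat \<iota> m a b p t)"
    and "\<And>t. mat_norm_inf (matrix_inv (Qmat \<iota> m a b p t)) < 1"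
  shows "reflection_op \<iota> m a b p \<in> C_n2pi \<rightarrow> C_n2pi \<and>
    bij_betw (\<lambda>v z. v z - reflection_op \<iota> m a b p v z) C_n2pi C_n2pi \<and>
    {u \<in> C_n2pi. u = reflection_op \<iota> m a b p u} = {\<lambda>z. 0}"
proof -
  interpret reflection_problem \<iota> m a b p
    by (intro reflection_problem.intro characteristic.intro assms)
  let ?R = "reflection_op \<iota> m a b p"
  have bij: "bij_betw (\<lambda>v z. v z - ?R v z) C_n2pi C_n2pi"
  proof (rule bij_betw_imageI)
    show "inj_on (\<lambda>v z. v z - ?R v z) C_n2pi"
    proof (rule inj_onI)
      fix u v
      assume u: "u \<in> C_n2pi" and v: "v \<in> C_n2pi" and eq: "(\<lambda>z. u z - ?R u z) = (\<lambda>z. v z - ?R v z)"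
      have "(\<lambda>z. v z - ?R v z) \<in> C_n2pi"
        by (intro C_n2pi_diff reflection_op_C_n2pi v)
      from reflection_equation_unique_solution[OF this] show "u = v"
        using u v eq by blast
    qed
    have "f \<in> (\<lambda>v z. v z - ?R v z) ` C_n2pi" if "f \<in> C_n2pi" for f
      using reflection_equation_unique_solution[OF that] by blast
    then show "(\<lambda>v z. v z - ?R v z) ` C_n2pi = C_n2pi"
      by (auto intro: C_n2pi_diff reflection_op_C_n2pi)
  qed
  have zero: "(\<lambda>z. 0) \<in> C_n2pi" "?R (\<lambda>z. 0) = (\<lambda>z. 0)"
    by (auto simp: C_n2pi_def reflection_op_def vec_eq_iff)
  \<comment> \<open>A fixed point of the operator and the zero function have the same image, namely
    zero, under the injective map of \<open>bij\<close>.\<close>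
  have "u = (\<lambda>z. 0)" if u: "u \<in> C_n2pi" "u = ?R u" for u
  proof (rule inj_onD[OF bij_betw_imp_inj_on[OF bij]])
    show "(\<lambda>z. u z - ?R u z) = (\<lambda>z. 0 - ?R (\<lambda>z. 0) z)"
      unfolding u(2)[symmetric] zero(2) by simp
  qed (rule u(1) zero(1))+
  then have "{u \<in> C_n2pi. u = ?R u} = {\<lambda>z. 0}"
    using zero(1) zero(2)[symmetric] by blast
  then show ?thesis
    by (intro conjI bij Pi_I reflection_op_C_n2pi)
qed

end
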